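(* Let $S$ be a quandle with a set of base points $\{b_i : i\in c(S)\}$ (with $b_i$ in the component $i$). Let $S/\gamma_S$ be given as the quandle of a 2-reductive mesh $(S_i,s_{i,j})_{i,j\in c(S)}$, where $S_i$ is the component of $S/\gamma_S$ which is the image of the component $i$ of $S$, and let $T$ be a 2-reductive quandle given as the quandle of a 2-reductive mesh $(T_i,t_{i,j})_{i,j\in c(T)}$. Let $g:c(S)\to c(T)$ be a map and for each $i\in c(S)$ let $e_i\in T_{g(i)}$. Then the following are equivalent: (i) there exists a quandle homomorphism $h:S\to T$ such that $\hat h=g$ and $h(b_i)=e_i$ for all $i\in c(S)$; (ii) for each $i\in c(S)$, the assignment $s_{j,i}\mapsto t_{g(j),g(i)}$ ($j\in c(S)$) induces a (well-defined) group homomorphism $k_i:S_i\to T_{g(i)}$; (iii) for any selection of elements $f_i\in T_{g(i)}$, $i\in c(S)$, there exists a unique quandle homomorphism $h:S\to T$ such that $h(b_i)=f_i$ for all $i\in c(S)$.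
   Context: A quandle is a set $Q$ with a binary operation $\triangleright$ such that $x\triangleright x=x$; for all $y,z$ there is a unique $x$ with $y\triangleright x=z$ (left divisibility); and $x\triangleright(y\triangleright z)=(x\triangleright y)\triangleright(x\triangleright z)$. It is 2-reductive if $(x\triangleright y)\triangleright z=y\triangleright z$ for all $x,y,z$. The components of $Q$ are the orbits of the group generated by the bijections $L_a:x\mapsto a\triangleright x$; $c(Q)$ is the set of components. A set of base points is a set consisting of exactly one element from each component. A homomorphism $h:S\to T$ sends each component of $S$ into a component of $T$; $\hat h:c(S)\to c(T)$ denotes the induced map. A congruence on $Q$ is an equivalence relation compatible with $\triangleright$ and with left division, so that the quotient is again a quandle. $\gamma_Q$ is the congruence on $Q$ generated by all pairs $((a\triangleright b)\triangleright c,\ b\triangleright c)$, $a,b,c\in Q$; it is the smallest congruence with 2-reductive quotient. Equivalent elements under $\gamma_Q$ lie in the same component, and the quotient map induces a bijection $c(Q)\to c(Q/\gamma_Q)$, by which $c(Q/\gamma_Q)$ is identified with $c(Q)$. A 2-reductive mesh $(A_i,c_{i,j})_{i,j\in I}$ consists of abelian groups $A_i$ and elements $c_{i,j}\in A_j$ with $c_{i,i}=0$ such that for each $j$ the elements $c_{i,j}$, $i\in I$, generate $A_j$. Its quandle is the disjoint union $\bigcup_i A_i$ with $a\triangleright b=c_{i,j}+b$ for $a\in A_i$, $b\in A_j$. It is known that this is a 2-reductive quandle with components $A_i$, and that every 2-reductive quandle arises this way, with index set its set of components. Thus the component of $T$ named by $j\in c(T)$ is $T_j$. *)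

theory Defs
  imports "HOL-Algebra.Algebra"
begin

record 'a binar = "'a partial_object" +
  tri :: "['a, 'a] \<Rightarrow> 'a" (infixl \<open>\<rhd>\<index>\<close> 70)

locale quandle =
  fixes Q (structure)
  assumes closed: "\<lbrakk>x \<in> carrier Q; y \<in> carrier Q\<rbrakk> \<Longrightarrow> x \<rhd> y \<in> carrier Q"
    and idem: "x \<in> carrier Q \<Longrightarrow> x \<rhd> x = x"
    and left_divisible: "\<lbrakk>y \<in> carrier Q; z \<in> carrier Q\<rbrakk> \<Longrightarrow> \<exists>!x. x \<in> carrier Q \<and> y \<rhd> x = z"
    and left_distrib: "\<lbrakk>x \<in> carrier Q; y \<in> carrier Q; z \<in> carrier Q\<rbrakk>
      \<Longrightarrow> x \<rhd> (y \<rhd> z) = (x \<rhd> y) \<rhd> (x \<rhd> z)"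

definition two_reductive :: "('a, 'm) binar_scheme \<Rightarrow> bool" where
  "two_reductive Q \<longleftrightarrow> (\<forall>x \<in> carrier Q. \<forall>y \<in> carrier Q. \<forall>z \<in> carrier Q.
     (x \<rhd>\<^bsub>Q\<^esub> y) \<rhd>\<^bsub>Q\<^esub> z = y \<rhd>\<^bsub>Q\<^esub> z)"

definition quandle_hom :: "('a, 'm) binar_scheme \<Rightarrow> ('b, 'n) binar_scheme \<Rightarrow> ('a \<Rightarrow> 'b) set" where
  "quandle_hom S T = {h \<in> carrier S \<rightarrow> carrier T.
     \<forall>x \<in> carrier S. \<forall>y \<in> carrier S. h (x \<rhd>\<^bsub>S\<^esub> y) = h x \<rhd>\<^bsub>T\<^esub> h y}"

text \<open>Left translations are restricted to the carrier because the elements of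
  \<^const>\<open>BijGroup\<close> are extensional functions.\<close>

definition left_translation :: "('a, 'm) binar_scheme \<Rightarrow> 'a \<Rightarrow> 'a \<Rightarrow> 'a" where
  "left_translation Q a = (\<lambda>x \<in> carrier Q. a \<rhd>\<^bsub>Q\<^esub> x)"

definition left_mult_group :: "('a, 'm) binar_scheme \<Rightarrow> ('a \<Rightarrow> 'a) monoid" where
  "left_mult_group Q =
     subgroup_generated (BijGroup (carrier Q)) (left_translation Q ` carrier Q)"

definition components :: "('a, 'm) binar_scheme \<Rightarrow> 'a set set" where
  "components Q = orbits (left_mult_group Q) (carrier Q) (\<lambda>f. f)"

definition induced_map ::
    "('a, 'm) binar_scheme \<Rightarrow> ('b, 'n) binar_scheme \<Rightarrow> ('a \<Rightarrow> 'b) \<Rightarrow> 'a set \<Rightarrow> 'b set" where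
  "induced_map S T h i = (THE j. j \<in> components T \<and> h ` i \<subseteq> j)"

definition left_div :: "('a, 'm) binar_scheme \<Rightarrow> 'a \<Rightarrow> 'a \<Rightarrow> 'a" where
  "left_div Q y z = (THE x. x \<in> carrier Q \<and> y \<rhd>\<^bsub>Q\<^esub> x = z)"

definition congruence_on :: "('a, 'm) binar_scheme \<Rightarrow> ('a \<times> 'a) set \<Rightarrow> bool" where
  "congruence_on Q r \<longleftrightarrow> equiv (carrier Q) r \<and>
     (\<forall>(x, x') \<in> r. \<forall>(y, y') \<in> r. (x \<rhd>\<^bsub>Q\<^esub> y, x' \<rhd>\<^bsub>Q\<^esub> y') \<in> r) \<and>
     (\<forall>(x, x') \<in> r. \<forall>(y, y') \<in> r. (left_div Q x y, left_div Q x' y') \<in> r)"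

definition gamma :: "('a, 'm) binar_scheme \<Rightarrow> ('a \<times> 'a) set" where
  "gamma Q = \<Inter>{r. congruence_on Q r \<and>
     (\<forall>a \<in> carrier Q. \<forall>b \<in> carrier Q. \<forall>c \<in> carrier Q.
        ((a \<rhd>\<^bsub>Q\<^esub> b) \<rhd>\<^bsub>Q\<^esub> c, b \<rhd>\<^bsub>Q\<^esub> c) \<in> r)}"

definition quotient_quandle :: "('a, 'm) binar_scheme \<Rightarrow> ('a \<times> 'a) set \<Rightarrow> 'a set binar" where
  "quotient_quandle Q r =
     \<lparr>carrier = carrier Q // r, tri = (\<lambda>U V. \<Union>x \<in> U. \<Union>y \<in> V. r `` {x \<rhd>\<^bsub>Q\<^esub> y})\<rparr>"

text \<open>The abelian groups of a mesh are written multiplicatively.\<close>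

definition two_reductive_mesh :: "'i set \<Rightarrow> ('i \<Rightarrow> 'a monoid) \<Rightarrow> ('i \<Rightarrow> 'i \<Rightarrow> 'a) \<Rightarrow> bool" where
  "two_reductive_mesh I A c \<longleftrightarrow>
     (\<forall>i \<in> I. comm_group (A i)) \<and>
     (\<forall>i \<in> I. \<forall>j \<in> I. c i j \<in> carrier (A j)) \<and>
     (\<forall>i \<in> I. c i i = \<one>\<^bsub>A i\<^esub>) \<and>
     (\<forall>j \<in> I. generate (A j) {c i j | i. i \<in> I} = carrier (A j))"

text \<open>The structure \<open>Q\<close> is the quandle of the mesh \<open>(A, c)\<close>: the groups have pairwise
  disjoint carriers, so that the disjoint union is an honest union of sets.\<close>

definition is_quandle_of_mesh ::
    "('a, 'm) binar_scheme \<Rightarrow> 'i set \<Rightarrow> ('i \<Rightarrow> 'a monoid) \<Rightarrow> ('i \<Rightarrow> 'i \<Rightarrow> 'a) \<Rightarrow> bool" where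
  "is_quandle_of_mesh Q I A c \<longleftrightarrow>
     two_reductive_mesh I A c \<and>
     disjoint_family_on (\<lambda>i. carrier (A i)) I \<and>
     carrier Q = (\<Union>i \<in> I. carrier (A i)) \<and>
     (\<forall>i \<in> I. \<forall>j \<in> I. \<forall>a \<in> carrier (A i). \<forall>b \<in> carrier (A j).
        a \<rhd>\<^bsub>Q\<^esub> b = c i j \<otimes>\<^bsub>A j\<^esub> b)"

end

theory Submission
  imports Defs
begin

text \<open>
  Write \<open>[x]\<close> for the class of \<open>x\<close> under \<open>gamma S\<close>. The kernel of a homomorphism \<open>h\<close> into a
  2-reductive quandle is a congruence containing \<open>gamma S\<close>, so \<open>h\<close> factors through \<open>p [x] = h x\<close>,
  and on each component \<open>p\<close> intertwines the translations by \<open>s j i\<close> and by \<open>t (g j) (g i)\<close>. As the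
  \<open>s j i\<close> generate the group, \<open>u \<mapsto> p u (p 1)\<^sup>-\<^sup>1\<close> is then a group homomorphism with \<open>s j i \<mapsto> t (g j) (g i)\<close>.
  Conversely, group homomorphisms \<open>k i\<close> yield the quandle homomorphism \<open>x \<mapsto> k i ([x] [b i]\<^sup>-\<^sup>1) f i\<close>
  on the component \<open>i\<close>. It is unique because two homomorphisms which map every component of \<open>S\<close>
  into the same component of \<open>T\<close> agree at \<open>a \<rhd> y\<close> if and only if they agree at \<open>y\<close>.
\<close>

section \<open>Generated permutation groups and intersections of equivalences\<close>

text \<open>Since \<open>P\<close> is required in both directions, invariance at the preimage of
  \<open>y\<close> also settles inverses of generators. Membership in \<open>Bij C\<close> is
  carried along so that products can be evaluated on \<open>C\<close>.\<close>

lemma BijGroup_generate_invariant: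
  assumes gens: "H \<subseteq> Bij C"
    and inv: "\<And>f y. f \<in> H \<Longrightarrow> y \<in> C \<Longrightarrow> P (f y) \<longleftrightarrow> P y"
    and f: "f \<in> generate (BijGroup C) H"
  shows "f \<in> Bij C \<and> (\<forall>y \<in> C. P (f y) \<longleftrightarrow> P y)"
  using f
proof (induction rule: generate.induct)
  case one
  have "\<one>\<^bsub>BijGroup C\<^esub> = (\<lambda>x \<in> C. x)" by (simp add: BijGroup_def)
  then show ?case using id_Bij by (metis restrict_apply')
next
  case (incl h)
  then show ?case using gens inv by auto
next
  case (inv h)
  then have h: "h \<in> Bij C" using gens by auto
  have "P (inv_into C h y) \<longleftrightarrow> P y" if "y \<in> C" for y
    using assms(2)[OF inv, of "inv_into C h y"] h that
    by (metis Bij_def Bij_inv_into_mem IntD2 bij_betw_inv_into_right mem_Collect_eq)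
  then have "\<forall>y \<in> C. P ((inv\<^bsub>BijGroup C\<^esub> h) y) \<longleftrightarrow> P y"
    by (simp add: inv_BijGroup[OF h])
  moreover have "inv\<^bsub>BijGroup C\<^esub> h \<in> Bij C"
    unfolding inv_BijGroup[OF h] using h by (rule restrict_inv_into_Bij)
  ultimately show ?case by blast
next
  case (eng h1 h2)
  then have "h2 y \<in> C" if "y \<in> C" for y
    using that Bij_imp_funcset by blast
  with eng show ?case by (auto simp: BijGroup_def compose_Bij compose_eq)
qed

lemma equiv_Inter:
  assumes "R \<noteq> {}" and eq: "\<And>r. r \<in> R \<Longrightarrow> equiv A r"
  shows "equiv A (\<Inter>R)"
proof (rule equivI)
  show "\<Inter>R \<subseteq> A \<times> A" using assms equiv_type by blast
  show "refl_on A (\<Inter>R)" using equiv_class_self[OF eq] by (auto intro!: refl_onI)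
  show "sym (\<Inter>R)" using eq by (auto intro!: symI elim!: equivE dest: symD)
  show "trans (\<Inter>R)" using eq by (intro transI) (meson Inter_iff equivE transD)
qed

section \<open>Components, left division and the congruence \<gamma> in a quandle\<close>

context quandle
begin

lemma bij_betw_tri:
  assumes "a \<in> carrier Q"
  shows "bij_betw (\<lambda>x. a \<rhd> x) (carrier Q) (carrier Q)"
  unfolding bij_betw_def
proof (intro conjI inj_onI equalityI subsetI)
  fix x y assume "x \<in> carrier Q" "y \<in> carrier Q" "a \<rhd> x = a \<rhd> y"
  then show "x = y" using left_divisible[OF assms] closed[OF assms] by metis
next
  fix z assume "z \<in> carrier Q"
  then show "z \<in> (\<lambda>x. a \<rhd> x) ` carrier Q" using left_divisible[OF assms] by blast
qed (use assms closed in auto)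

lemma left_translation_Bij: "a \<in> carrier Q \<Longrightarrow> left_translation Q a \<in> Bij (carrier Q)"
  using bij_betw_tri by (simp add: left_translation_def Bij_def)

lemma left_mult_group_invariant:
  assumes "\<And>a y. a \<in> carrier Q \<Longrightarrow> y \<in> carrier Q \<Longrightarrow> P (a \<rhd> y) \<longleftrightarrow> P y"
    and "f \<in> carrier (left_mult_group Q)"
  shows "f \<in> Bij (carrier Q) \<and> (\<forall>y \<in> carrier Q. P (f y) \<longleftrightarrow> P y)"
proof (rule BijGroup_generate_invariant)
  show "left_translation Q ` carrier Q \<subseteq> Bij (carrier Q)"
    using left_translation_Bij by auto
  then show "f \<in> generate (BijGroup (carrier Q)) (left_translation Q ` carrier Q)"
    using assms(2)
    by (simp add: left_mult_group_def carrier_subgroup_generated BijGroup_def Int_absorb1)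
qed (use assms(1) in \<open>auto simp: left_translation_def\<close>)

lemma component_cases:
  assumes "i \<in> components Q"
  obtains x where "x \<in> carrier Q" "i = {f x | f. f \<in> carrier (left_mult_group Q)}"
  using assms by (auto simp: components_def orbits_def orbit_def)

lemma component_subset:
  assumes "i \<in> components Q"
  shows "i \<subseteq> carrier Q"
  using assms
proof (cases rule: component_cases)
  case (1 x)
  then show ?thesis
    using left_mult_group_invariant[of "\<lambda>_. True"] Bij_imp_funcset by blast
qed

text \<open>This spares later arguments all words in translations and their inverses. It is applied
  with \<open>P\<close> saying that a homomorphism takes values in a given group of the mesh, and
  with \<open>P\<close> saying that two homomorphisms agree.\<close>

lemma component_invariant:
  assumes "i \<in> components Q" "x \<in> i" "y \<in> i"
    and "\<And>a y. a \<in> carrier Q \<Longrightarrow> y \<in> carrier Q \<Longrightarrow> P (a \<rhd> y) \<longleftrightarrow> P y"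
  shows "P x \<longleftrightarrow> P y"
  using assms(1)
proof (cases rule: component_cases)
  case (1 z)
  then show ?thesis
    using left_mult_group_invariant[of P] assms(2-4) by blast
qed

lemma component_exists:
  assumes "x \<in> carrier Q"
  obtains i where "i \<in> components Q" "x \<in> i"
proof
  show "orbit (left_mult_group Q) (\<lambda>f. f) x \<in> components Q"
    using assms by (auto simp: components_def orbits_def)
  have "(\<lambda>x \<in> carrier Q. x) \<in> carrier (left_mult_group Q)"
    using generate.one[of "BijGroup (carrier Q)"]
    by (simp add: left_mult_group_def carrier_subgroup_generated BijGroup_def)
  then show "x \<in> orbit (left_mult_group Q) (\<lambda>f. f) x"
    using assms unfolding orbit_def by (intro CollectI exI[of _ "\<lambda>x \<in> carrier Q. x"]) simp
qed

lemma left_div: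
  assumes "y \<in> carrier Q" "z \<in> carrier Q"
  shows "left_div Q y z \<in> carrier Q" "y \<rhd> left_div Q y z = z"
  using theI'[OF left_divisible[OF assms]] by (auto simp: left_div_def)

lemma left_div_unique:
  assumes "y \<in> carrier Q" "x \<in> carrier Q" "y \<rhd> x = z"
  shows "left_div Q y z = x"
  using assms left_divisible[of y z] closed left_div[of y z] by blast

lemma congruence_on_gamma: "congruence_on Q (gamma Q)"
proof -
  define R where "R = {r. congruence_on Q r \<and>
    (\<forall>a \<in> carrier Q. \<forall>b \<in> carrier Q. \<forall>c \<in> carrier Q. ((a \<rhd> b) \<rhd> c, b \<rhd> c) \<in> r)}"
  have gamma_R: "gamma Q = \<Inter>R" by (simp add: gamma_def R_def)
  have R: "congruence_on Q r" if "r \<in> R" for r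
    using that by (simp add: R_def)
  \<comment> \<open>The full relation shows that the family \<open>R\<close> is nonempty, so its
    intersection stays inside the carrier.\<close>
  have "carrier Q \<times> carrier Q \<in> R"
    using closed left_div
    by (auto simp: R_def congruence_on_def equiv_def refl_on_def sym_def trans_def)
  then have eq: "equiv (carrier Q) (\<Inter>R)"
    using R by (intro equiv_Inter) (auto simp: congruence_on_def)
  have "(x \<rhd> y, x' \<rhd> y') \<in> r \<and> (left_div Q x y, left_div Q x' y') \<in> r"
    if "(x, x') \<in> \<Inter>R" "(y, y') \<in> \<Inter>R" "r \<in> R" for x x' y y' r
    using R[OF that(3)] that unfolding congruence_on_def by fast
  then show ?thesis
    using eq unfolding congruence_on_def gamma_R by blast
qed

text \<open>By compatibility all terms of the double union in \<open>quotient_quandle\<close> are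
  one and the same class, and both index sets are nonempty.\<close>

lemma gamma_class_tri:
  assumes "x \<in> carrier Q" "y \<in> carrier Q"
  shows "gamma Q `` {x} \<rhd>\<^bsub>quotient_quandle Q (gamma Q)\<^esub> gamma Q `` {y} = gamma Q `` {x \<rhd> y}"
proof -
  have eq: "equiv (carrier Q) (gamma Q)"
    and comp: "\<And>x x' y y'. (x, x') \<in> gamma Q \<Longrightarrow> (y, y') \<in> gamma Q
      \<Longrightarrow> (x \<rhd> y, x' \<rhd> y') \<in> gamma Q"
    using congruence_on_gamma by (auto simp: congruence_on_def)
  have *: "gamma Q `` {x' \<rhd> y'} = gamma Q `` {x \<rhd> y}"
    if "x' \<in> gamma Q `` {x}" "y' \<in> gamma Q `` {y}" for x' y'
    using that comp equiv_class_eq[OF eq] by blast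
  have "x \<in> gamma Q `` {x}" "y \<in> gamma Q `` {y}"
    using assms equiv_class_self[OF eq] by auto
  then have "(\<Union>x' \<in> gamma Q `` {x}. \<Union>y' \<in> gamma Q `` {y}. gamma Q `` {x' \<rhd> y'})
      = gamma Q `` {x \<rhd> y}"
    by (intro UN_constant_eq[of x] UN_constant_eq[of y] ballI *)
  then show ?thesis by (simp add: quotient_quandle_def)
qed

end

section \<open>Quandle homomorphisms and their kernels\<close>

lemma quandle_hom_closed: "h \<in> quandle_hom S T \<Longrightarrow> x \<in> carrier S \<Longrightarrow> h x \<in> carrier T"
  by (auto simp: quandle_hom_def)

lemma quandle_hom_tri:
  "h \<in> quandle_hom S T \<Longrightarrow> x \<in> carrier S \<Longrightarrow> y \<in> carrier S
    \<Longrightarrow> h (x \<rhd>\<^bsub>S\<^esub> y) = h x \<rhd>\<^bsub>T\<^esub> h y"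
  by (auto simp: quandle_hom_def)

lemma quandle_hom_left_div:
  assumes "quandle S" "quandle T" "h \<in> quandle_hom S T" "x \<in> carrier S" "y \<in> carrier S"
  shows "h (left_div S x y) = left_div T (h x) (h y)"
proof -
  have d: "left_div S x y \<in> carrier S" "x \<rhd>\<^bsub>S\<^esub> left_div S x y = y"
    using quandle.left_div[OF assms(1,4,5)] .
  then have "h x \<rhd>\<^bsub>T\<^esub> h (left_div S x y) = h y"
    using quandle_hom_tri[OF assms(3,4) d(1)] by simp
  then show ?thesis
    using quandle.left_div_unique[OF assms(2)] quandle_hom_closed[OF assms(3)] assms(4) d(1) by metis
qed

lemma congruence_on_kernel:
  assumes "quandle S" "quandle T" "h \<in> quandle_hom S T"
  shows "congruence_on S {(x, y). x \<in> carrier S \<and> y \<in> carrier S \<and> h x = h y}"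
  using assms quandle.closed[OF assms(1)] quandle.left_div(1)[OF assms(1)]
  by (auto simp: congruence_on_def equiv_def refl_on_def sym_def trans_def
      quandle_hom_tri quandle_hom_left_div)

text \<open>2-reductivity of \<open>T\<close> puts the generating pairs of \<gamma> into the kernel
  of \<open>h\<close>, which is therefore one of the relations intersected in
  \<open>gamma S\<close>.\<close>

lemma gamma_subset_kernel:
  assumes "quandle S" "quandle T" "two_reductive T" "h \<in> quandle_hom S T"
    and "(x, y) \<in> gamma S"
  shows "h x = h y"
proof -
  let ?r = "{(x, y). x \<in> carrier S \<and> y \<in> carrier S \<and> h x = h y}"
  have "((a \<rhd>\<^bsub>S\<^esub> b) \<rhd>\<^bsub>S\<^esub> c, b \<rhd>\<^bsub>S\<^esub> c) \<in> ?r"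
    if "a \<in> carrier S" "b \<in> carrier S" "c \<in> carrier S" for a b c
    using that assms quandle.closed[OF assms(1)]
    by (simp add: quandle_hom_tri quandle_hom_closed two_reductive_def)
  then have "gamma S \<subseteq> ?r"
    using congruence_on_kernel[OF assms(1,2,4)] unfolding gamma_def by blast
  then show ?thesis using assms(5) by auto
qed

section \<open>Group homomorphisms from equivariant maps\<close>

text \<open>Multiplying \<open>p\<close> on the right by the inverse of its value at the unit does
  not disturb equivariance under left multiplication, and it makes the unit go to the unit.
  Multiplicativity then spreads from generators to all products.\<close>

lemma hom_of_equivariant_map:
  assumes A: "group A" and B: "group B"
    and C: "C \<subseteq> carrier A" and D: "\<And>x. x \<in> C \<Longrightarrow> d x \<in> carrier B"
    and gen: "generate A C = carrier A"
    and p: "p \<in> carrier A \<rightarrow> carrier B"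
    and eqv: "\<And>x u. x \<in> C \<Longrightarrow> u \<in> carrier A \<Longrightarrow> p (x \<otimes>\<^bsub>A\<^esub> u) = d x \<otimes>\<^bsub>B\<^esub> p u"
  shows "\<exists>k \<in> hom A B. \<forall>x \<in> C. k x = d x"
proof -
  interpret A: group A by fact
  interpret B: group B by fact
  define k where "k u = p u \<otimes>\<^bsub>B\<^esub> inv\<^bsub>B\<^esub> p \<one>\<^bsub>A\<^esub>" for u
  have pc: "p u \<in> carrier B" if "u \<in> carrier A" for u using p that by auto
  have kc: "k u \<in> carrier B" if "u \<in> carrier A" for u using pc that by (simp add: k_def)
  have k1: "k \<one>\<^bsub>A\<^esub> = \<one>\<^bsub>B\<^esub>" using pc by (simp add: k_def)
  have kd: "k (x \<otimes>\<^bsub>A\<^esub> u) = d x \<otimes>\<^bsub>B\<^esub> k u" if "x \<in> C" "u \<in> carrier A" for x u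
    using that D eqv pc by (simp add: k_def B.m_assoc)
  have kC: "k x = d x" if "x \<in> C" for x
    using kd[OF that A.one_closed] k1 C D that by auto
  have kinv: "k (inv\<^bsub>A\<^esub> x \<otimes>\<^bsub>A\<^esub> u) = inv\<^bsub>B\<^esub> d x \<otimes>\<^bsub>B\<^esub> k u"
    if x: "x \<in> C" and u: "u \<in> carrier A" for x u
  proof -
    have xA: "x \<in> carrier A" using x C by auto
    have "k u = d x \<otimes>\<^bsub>B\<^esub> k (inv\<^bsub>A\<^esub> x \<otimes>\<^bsub>A\<^esub> u)"
      using kd[OF x, of "inv\<^bsub>A\<^esub> x \<otimes>\<^bsub>A\<^esub> u"] xA u by (simp add: A.m_assoc[symmetric])
    then show ?thesis
      using D[OF x] kc xA u by (simp add: B.m_assoc[symmetric])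
  qed
  \<comment> \<open>The right factor \<open>v\<close> is quantified inside the induction: for a
    product of \<open>u\<close> and \<open>w\<close>, the hypothesis for \<open>u\<close> is needed
    at \<open>w\<close> times \<open>v\<close> and at \<open>w\<close>.\<close>
  have "\<forall>v \<in> carrier A. k (u \<otimes>\<^bsub>A\<^esub> v) = k u \<otimes>\<^bsub>B\<^esub> k v" if "u \<in> generate A C" for u
    using that
  proof (induction rule: generate.induct)
    case one
    then show ?case using k1 kc by simp
  next
    case (incl x)
    then show ?case using kd kC by simp
  next
    case (inv x)
    have "k (inv\<^bsub>A\<^esub> x) = inv\<^bsub>B\<^esub> d x"
      using kinv[OF inv A.one_closed] k1 inv C D by auto
    then show ?case using kinv inv by simp
  next
    case (eng u w)
    then have "u \<in> carrier A" "w \<in> carrier A" using gen by auto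
    then show ?case using eng.IH kc by (simp add: A.m_assoc B.m_assoc)
  qed
  then have "k \<in> hom A B" using gen kc by (auto simp: hom_def)
  then show ?thesis using kC by blast
qed

section \<open>Quandles of meshes\<close>

lemma mesh_comm_group: "is_quandle_of_mesh Q I A c \<Longrightarrow> i \<in> I \<Longrightarrow> comm_group (A i)"
  by (simp add: is_quandle_of_mesh_def two_reductive_mesh_def)

lemma mesh_group: "is_quandle_of_mesh Q I A c \<Longrightarrow> i \<in> I \<Longrightarrow> group (A i)"
  by (rule comm_group.axioms(2)) (rule mesh_comm_group)

lemma mesh_const_closed:
  "is_quandle_of_mesh Q I A c \<Longrightarrow> i \<in> I \<Longrightarrow> j \<in> I \<Longrightarrow> c i j \<in> carrier (A j)"
  by (simp add: is_quandle_of_mesh_def two_reductive_mesh_def)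

lemma mesh_generate:
  "is_quandle_of_mesh Q I A c \<Longrightarrow> j \<in> I \<Longrightarrow> generate (A j) {c i j | i. i \<in> I} = carrier (A j)"
  by (simp add: is_quandle_of_mesh_def two_reductive_mesh_def)

lemma mesh_tri:
  "is_quandle_of_mesh Q I A c \<Longrightarrow> i \<in> I \<Longrightarrow> j \<in> I \<Longrightarrow> x \<in> carrier (A i) \<Longrightarrow> y \<in> carrier (A j)
    \<Longrightarrow> x \<rhd>\<^bsub>Q\<^esub> y = c i j \<otimes>\<^bsub>A j\<^esub> y"
  by (simp add: is_quandle_of_mesh_def)

lemma mesh_disjoint:
  "is_quandle_of_mesh Q I A c \<Longrightarrow> i \<in> I \<Longrightarrow> j \<in> I \<Longrightarrow> x \<in> carrier (A i) \<Longrightarrow> x \<in> carrier (A j)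
    \<Longrightarrow> i = j"
  by (auto simp: is_quandle_of_mesh_def disjoint_family_on_def)

lemma mesh_carrier: "is_quandle_of_mesh Q I A c \<Longrightarrow> carrier Q = (\<Union>i \<in> I. carrier (A i))"
  by (simp add: is_quandle_of_mesh_def)

lemma mesh_tri_closed:
  assumes "is_quandle_of_mesh Q I A c" "x \<in> carrier Q" "j \<in> I" "y \<in> carrier (A j)"
  shows "x \<rhd>\<^bsub>Q\<^esub> y \<in> carrier (A j)"
proof -
  obtain i where i: "i \<in> I" "x \<in> carrier (A i)" using assms mesh_carrier by blast
  interpret group "A j" by (rule mesh_group[OF assms(1,3)])
  show ?thesis using mesh_tri[OF assms(1) i(1) assms(3) i(2) assms(4)]
      mesh_const_closed[OF assms(1) i(1) assms(3)] assms(4) by simp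
qed

text \<open>Translations map each group of the mesh into itself, and disjointness gives the
  converse. This is the form that \<open>quandle.component_invariant\<close> asks for.\<close>

lemma mesh_tri_mem_iff:
  assumes "is_quandle_of_mesh Q I A c" "x \<in> carrier Q" "j \<in> I" "y \<in> carrier Q"
  shows "x \<rhd>\<^bsub>Q\<^esub> y \<in> carrier (A j) \<longleftrightarrow> y \<in> carrier (A j)"
  using assms mesh_tri_closed[OF assms(1,2)] mesh_disjoint[OF assms(1)] mesh_carrier[OF assms(1)]
  by (metis UN_E)

text \<open>Even if \<open>x\<close> and \<open>x'\<close> differ, both act on \<open>A j\<close> by
  the constant \<open>c i j\<close>, which cancels.\<close>

lemma mesh_tri_cancel:
  assumes m: "is_quandle_of_mesh Q I A c" and "i \<in> I" "j \<in> I"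
    and "x \<in> carrier (A i)" "x' \<in> carrier (A i)" "y \<in> carrier (A j)" "y' \<in> carrier (A j)"
  shows "x \<rhd>\<^bsub>Q\<^esub> y = x' \<rhd>\<^bsub>Q\<^esub> y' \<longleftrightarrow> y = y'"
proof -
  interpret group "A j" by (rule mesh_group[OF assms(1,3)])
  show ?thesis using assms by (simp add: mesh_tri[OF m] mesh_const_closed[OF m])
qed

lemma quandle_hom_component:
  assumes S: "quandle S" and m: "is_quandle_of_mesh T J TT t" and h: "h \<in> quandle_hom S T"
    and i: "i \<in> components S" "x \<in> i" "y \<in> i" and j: "j \<in> J" "h x \<in> carrier (TT j)"
  shows "h y \<in> carrier (TT j)"
proof -
  have "h x \<in> carrier (TT j) \<longleftrightarrow> h y \<in> carrier (TT j)"
    using i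
  proof (rule quandle.component_invariant[OF S])
    fix a y assume "a \<in> carrier S" "y \<in> carrier S"
    then show "h (a \<rhd>\<^bsub>S\<^esub> y) \<in> carrier (TT j) \<longleftrightarrow> h y \<in> carrier (TT j)"
      using mesh_tri_mem_iff[OF m _ j(1)] h by (simp add: quandle_hom_tri quandle_hom_closed)
  qed
  then show ?thesis using j by blast
qed

section \<open>The equivalence of the three conditions\<close>

text \<open>Uniqueness in (iii) is stated among functions extensional on \<open>carrier S\<close>,
  since being a homomorphism says nothing about values elsewhere.\<close>

theorem corollary3p24:
  fixes S :: "'s binar" and T :: "'t binar"
    and b :: "'s set \<Rightarrow> 's"
    and SS :: "'s set \<Rightarrow> 's set monoid" and s :: "'s set \<Rightarrow> 's set \<Rightarrow> 's set"
    and TT :: "'t set \<Rightarrow> 't monoid" and t :: "'t set \<Rightarrow> 't set \<Rightarrow> 't"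
    and g :: "'s set \<Rightarrow> 't set" and e :: "'s set \<Rightarrow> 't"
  assumes S: "quandle S"
    and base_points: "\<And>i. i \<in> components S \<Longrightarrow> b i \<in> i"
    and S_mesh: "is_quandle_of_mesh (quotient_quandle S (gamma S)) (components S) SS s"
    and S_index: "\<And>i. i \<in> components S \<Longrightarrow> carrier (SS i) = (\<lambda>x. gamma S `` {x}) ` i"
    and T: "quandle T" "two_reductive T"
    and T_mesh: "is_quandle_of_mesh T (components T) TT t"
    and T_index: "\<And>j. j \<in> components T \<Longrightarrow> carrier (TT j) = j"
    and g: "g \<in> components S \<rightarrow> components T"
    and e: "\<And>i. i \<in> components S \<Longrightarrow> e i \<in> carrier (TT (g i))"
  shows "((\<exists>h \<in> quandle_hom S T.
             (\<forall>i \<in> components S. induced_map S T h i = g i) \<and>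
             (\<forall>i \<in> components S. h (b i) = e i))
          \<longleftrightarrow>
          (\<forall>i \<in> components S. \<exists>k \<in> hom (SS i) (TT (g i)).
             \<forall>j \<in> components S. k (s j i) = t (g j) (g i)))
       \<and> ((\<forall>i \<in> components S. \<exists>k \<in> hom (SS i) (TT (g i)).
             \<forall>j \<in> components S. k (s j i) = t (g j) (g i))
          \<longleftrightarrow>
          (\<forall>f. (\<forall>i \<in> components S. f i \<in> carrier (TT (g i))) \<longrightarrow>
             (\<exists>!h. h \<in> quandle_hom S T \<inter> extensional (carrier S) \<and>
                (\<forall>i \<in> components S. h (b i) = f i))))"
proof -
  let ?I = "components S" and ?J = "components T" and ?c = "\<lambda>x. gamma S `` {x}"
  \<comment> \<open>This is condition (ii). The proof runs in a cycle: \<open>hom_imp\<close> gives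
    (i) to (ii), \<open>imp_hom\<close> gives (ii) to (iii), and \<open>ex\<close> gives (iii) to
    (i).\<close>
  define grp_homs where "grp_homs \<longleftrightarrow>
    (\<forall>i \<in> ?I. \<exists>k \<in> hom (SS i) (TT (g i)). \<forall>j \<in> ?I. k (s j i) = t (g j) (g i))"
  interpret S: quandle S by fact
  have gJ: "g i \<in> ?J" if "i \<in> ?I" for i using g that by auto
  have in_S: "x \<in> carrier S" if "i \<in> ?I" "x \<in> i" for i x using S.component_subset that by blast
  have cl: "?c x \<in> carrier (SS i)" if "i \<in> ?I" "x \<in> i" for i x using S_index that by auto
  \<comment> \<open>Disjointness of the components of \<open>S\<close> is read off from the disjoint
    groups \<open>SS i\<close> that contain their classes.\<close>
  have comp_unique: "i = i'" if "i \<in> ?I" "i' \<in> ?I" "x \<in> i" "x \<in> i'" for i i' x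
    using mesh_disjoint[OF S_mesh] cl that by blast
  have c_tri: "?c (x \<rhd>\<^bsub>S\<^esub> y) = s j i \<otimes>\<^bsub>SS i\<^esub> ?c y"
    if "j \<in> ?I" "i \<in> ?I" "x \<in> j" "y \<in> i" for i j x y
    using S.gamma_class_tri in_S cl mesh_tri[OF S_mesh] that by metis
  have tri_comp: "x \<rhd>\<^bsub>S\<^esub> y \<in> i" if xy: "j \<in> ?I" "i \<in> ?I" "x \<in> j" "y \<in> i" for i j x y
  proof -
    interpret group "SS i" by (rule mesh_group[OF S_mesh xy(2)])
    obtain i' where i': "i' \<in> ?I" "x \<rhd>\<^bsub>S\<^esub> y \<in> i'"
      using S.component_exists S.closed in_S xy by metis
    have "?c (x \<rhd>\<^bsub>S\<^esub> y) \<in> carrier (SS i)"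
      using c_tri[OF xy] cl xy mesh_const_closed[OF S_mesh] by simp
    then show ?thesis using mesh_disjoint[OF S_mesh] cl i' xy by metis
  qed
  have to_comp: "h x \<in> carrier (TT (g i))"
    if "h \<in> quandle_hom S T" "i \<in> ?I" "x \<in> i" "h (b i) \<in> carrier (TT (g i))" for h i x
    using quandle_hom_component[OF S T_mesh that(1,2) base_points[OF that(2)] that(3) gJ] that by blast
  have induced: "induced_map S T h i = g i"
    if "h \<in> quandle_hom S T" "i \<in> ?I" "h (b i) \<in> carrier (TT (g i))" for h i
    unfolding induced_map_def
  proof (rule the_equality)
    show "g i \<in> ?J \<and> h ` i \<subseteq> g i"
      using gJ to_comp[OF that(1,2)] that T_index by auto
    fix j assume "j \<in> ?J \<and> h ` i \<subseteq> j"
    then show "j = g i"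
      using mesh_disjoint[OF T_mesh] gJ that T_index base_points[OF that(2)] by blast
  qed
  have hom_imp: grp_homs
    if h: "h \<in> quandle_hom S T" and hb: "\<forall>i \<in> ?I. h (b i) = e i" for h
    unfolding grp_homs_def
  proof
    fix i assume i: "i \<in> ?I"
    have hi: "h x \<in> carrier (TT (g j))" if "j \<in> ?I" "x \<in> j" for j x
      using to_comp[OF h that] hb e that by simp
    \<comment> \<open>\<open>p\<close> is \<open>h\<close> read on \<gamma>-classes; the choice of
      representative is harmless by \<open>gamma_subset_kernel\<close>.\<close>
    define p where "p u = h (SOME x. x \<in> i \<and> u = ?c x)" for u
    have p: "p (?c x) = h x" if "x \<in> i" for x
    proof -
      let ?y = "SOME y. y \<in> i \<and> ?c x = ?c y"
      have "?y \<in> i \<and> ?c x = ?c ?y" by (rule someI[of _ x]) (use that in auto)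
      moreover have "equiv (carrier S) (gamma S)"
        using S.congruence_on_gamma by (simp add: congruence_on_def)
      ultimately have "(x, ?y) \<in> gamma S"
        using in_S[OF i] by (meson eq_equiv_class)
      then show ?thesis using gamma_subset_kernel[OF S T h] by (simp add: p_def)
    qed
    \<comment> \<open>Well-definedness of the assignment in (ii): \<open>p\<close> sends the class
      of \<open>b i\<close>, translated by \<open>s j i\<close>, to \<open>t (g j) (g i)\<close>
      times \<open>h (b i)\<close>, and \<open>h (b i)\<close> cancels.\<close>
    have s_inj: "t (g j) (g i) = t (g j') (g i)" if "j \<in> ?I" "j' \<in> ?I" "s j i = s j' i" for j j'
    proof -
      interpret group "TT (g i)" by (rule mesh_group[OF T_mesh gJ[OF i]])
      have *: "p (s j i \<otimes>\<^bsub>SS i\<^esub> ?c (b i)) = t (g j) (g i) \<otimes>\<^bsub>TT (g i)\<^esub> h (b i)" if "j \<in> ?I" for j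
        using that i c_tri[of j i "b j" "b i"] tri_comp[of j i "b j" "b i"] p base_points in_S
          mesh_tri[OF T_mesh gJ gJ hi hi] by (metis quandle_hom_tri[OF h])
      show ?thesis
        using *[OF that(1)] *[OF that(2)] that(3) mesh_const_closed[OF T_mesh gJ gJ] hi[OF i base_points[OF i]]
          that i by simp
    qed
    \<comment> \<open>\<open>d\<close> turns the assignment, indexed by \<open>j\<close>, into a
      function of the group element, as \<open>hom_of_equivariant_map\<close> expects.\<close>
    define d where "d u = t (g (SOME j. j \<in> ?I \<and> u = s j i)) (g i)" for u
    have d: "d (s j i) = t (g j) (g i)" if "j \<in> ?I" for j
    proof -
      let ?j = "SOME j'. j' \<in> ?I \<and> s j i = s j' i"
      have "?j \<in> ?I \<and> s j i = s ?j i" by (rule someI[of _ j]) (use that in auto)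
      then show ?thesis using s_inj[of ?j j] that by (simp add: d_def)
    qed
    have "\<exists>k \<in> hom (SS i) (TT (g i)). \<forall>x \<in> {s j i | j. j \<in> ?I}. k x = d x"
    proof (rule hom_of_equivariant_map)
      show "p \<in> carrier (SS i) \<rightarrow> carrier (TT (g i))"
        using p hi[OF i] S_index[OF i] by auto
      \<comment> \<open>Multiplication by \<open>s j i\<close> is realised in \<open>S\<close> by
        the translation by the base point \<open>b j\<close>.\<close>
      fix x u assume "x \<in> {s j i | j. j \<in> ?I}" "u \<in> carrier (SS i)"
      then obtain j y where "j \<in> ?I" "x = s j i" "y \<in> i" "u = ?c y"
        using S_index[OF i] by auto
      then show "p (x \<otimes>\<^bsub>SS i\<^esub> u) = d x \<otimes>\<^bsub>TT (g i)\<^esub> p u"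
        using d p c_tri[of j i "b j" y] tri_comp[of j i "b j" y] base_points i in_S
          mesh_tri[OF T_mesh gJ gJ hi hi] by (metis quandle_hom_tri[OF h])
    qed (use i mesh_group[OF S_mesh] mesh_group[OF T_mesh] gJ mesh_const_closed[OF S_mesh] d
          mesh_const_closed[OF T_mesh] mesh_generate[OF S_mesh] in auto)
    then show "\<exists>k \<in> hom (SS i) (TT (g i)). \<forall>j \<in> ?I. k (s j i) = t (g j) (g i)"
      using d by (metis (mono_tags, lifting) mem_Collect_eq)
  qed
  have imp_hom: "\<exists>!h. h \<in> quandle_hom S T \<inter> extensional (carrier S) \<and> (\<forall>i \<in> ?I. h (b i) = f i)"
    if grp_homs and f: "\<forall>i \<in> ?I. f i \<in> carrier (TT (g i))" for f
  proof -
    obtain k where k: "\<And>i. i \<in> ?I \<Longrightarrow> k i \<in> hom (SS i) (TT (g i))"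
      "\<And>i j. i \<in> ?I \<Longrightarrow> j \<in> ?I \<Longrightarrow> k i (s j i) = t (g j) (g i)"
      using \<open>grp_homs\<close> unfolding grp_homs_def by metis
    \<comment> \<open>Dividing by the class of \<open>b i\<close> makes the argument of
      \<open>k i\<close> trivial at \<open>b i\<close>, so that \<open>q i\<close> takes the
      prescribed value \<open>f i\<close> there.\<close>
    define q where "q i x = k i (?c x \<otimes>\<^bsub>SS i\<^esub> inv\<^bsub>SS i\<^esub> ?c (b i)) \<otimes>\<^bsub>TT (g i)\<^esub> f i" for i x
    \<comment> \<open>The maps \<open>q i\<close> are glued along the components; restricting to the
      carrier makes \<open>h\<close> extensional.\<close>
    define h where "h = (\<lambda>x \<in> carrier S. q (THE i. i \<in> ?I \<and> x \<in> i) x)"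
    have h: "h x = q i x" if "i \<in> ?I" "x \<in> i" for i x
    proof -
      have "(THE i. i \<in> ?I \<and> x \<in> i) = i"
        by (intro the_equality; metis comp_unique that)
      then show ?thesis using in_S that by (simp add: h_def)
    qed
    have q: "q i (b i) = f i \<and> (\<forall>x \<in> i. q i x \<in> carrier (TT (g i))) \<and>
        (\<forall>j \<in> ?I. \<forall>x \<in> j. \<forall>y \<in> i. q i (x \<rhd>\<^bsub>S\<^esub> y) = t (g j) (g i) \<otimes>\<^bsub>TT (g i)\<^esub> q i y)"
      if i: "i \<in> ?I" for i
    proof -
      interpret A: group "SS i" using mesh_group[OF S_mesh i] .
      interpret B: group "TT (g i)" using mesh_group[OF T_mesh gJ[OF i]] .
      interpret K: group_hom "SS i" "TT (g i)" "k i" by unfold_locales (rule k(1)[OF i])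
      show ?thesis
        using i f base_points[OF i] cl[OF i] mesh_const_closed[OF S_mesh _ i] k(2)
        by (auto simp: q_def c_tri A.m_assoc B.m_assoc mesh_const_closed[OF T_mesh gJ gJ])
    qed
    have hc: "h x \<in> carrier (TT (g i))" if "i \<in> ?I" "x \<in> i" for i x
      using q h that by simp
    have h_hom: "h \<in> quandle_hom S T"
      unfolding quandle_hom_def
    proof (intro CollectI conjI ballI Pi_I)
      fix x assume "x \<in> carrier S"
      then obtain i where "i \<in> ?I" "x \<in> i" using S.component_exists by blast
      then show "h x \<in> carrier T" using hc gJ mesh_carrier[OF T_mesh] by blast
    next
      fix x y assume "x \<in> carrier S" "y \<in> carrier S"
      then obtain i j where ij: "i \<in> ?I" "y \<in> i" "j \<in> ?I" "x \<in> j"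
        using S.component_exists by metis
      then have "h (x \<rhd>\<^bsub>S\<^esub> y) = t (g j) (g i) \<otimes>\<^bsub>TT (g i)\<^esub> h y"
        using q h tri_comp by simp
      then show "h (x \<rhd>\<^bsub>S\<^esub> y) = h x \<rhd>\<^bsub>T\<^esub> h y"
        using mesh_tri[OF T_mesh gJ gJ hc hc] ij by simp
    qed
    show ?thesis
    proof (rule ex1I[of _ h])
      show "h \<in> quandle_hom S T \<inter> extensional (carrier S) \<and> (\<forall>i \<in> ?I. h (b i) = f i)"
        using h_hom q h base_points by (simp add: h_def)
      fix h' assume h': "h' \<in> quandle_hom S T \<inter> extensional (carrier S) \<and> (\<forall>i \<in> ?I. h' (b i) = f i)"
      have hc': "h' x \<in> carrier (TT (g i))" if "i \<in> ?I" "x \<in> i" for i x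
        using to_comp[of h' i x] h' f that by auto
      show "h' = h"
      proof (rule extensionalityI)
        fix x assume "x \<in> carrier S"
        then obtain i where i: "i \<in> ?I" "x \<in> i" using S.component_exists by blast
        \<comment> \<open>Agreement travels along the component \<open>i\<close> from the base
          point. The values \<open>h' a\<close> and \<open>h a\<close> need not be known to agree:
          they lie in the same group of the mesh and so translate alike.\<close>
        have "h' x = h x \<longleftrightarrow> h' (b i) = h (b i)"
        proof (rule S.component_invariant[OF i base_points[OF i(1)]])
          fix a y assume ay: "a \<in> carrier S" "y \<in> carrier S"
          then obtain j l where "j \<in> ?I" "a \<in> j" "l \<in> ?I" "y \<in> l"
            using S.component_exists by metis
          then have "h' a \<rhd>\<^bsub>T\<^esub> h' y = h a \<rhd>\<^bsub>T\<^esub> h y \<longleftrightarrow> h' y = h y"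
            using mesh_tri_cancel[OF T_mesh gJ gJ hc' hc hc' hc] by blast
          then show "h' (a \<rhd>\<^bsub>S\<^esub> y) = h (a \<rhd>\<^bsub>S\<^esub> y) \<longleftrightarrow> h' y = h y"
            using ay h' h_hom quandle_hom_tri[of h' S T a y] quandle_hom_tri[of h S T a y] by simp
        qed
        then show "h' x = h x" using h' q h i base_points by simp
      qed (use h' in \<open>auto simp: h_def\<close>)
    qed
  qed
  have ex: "\<exists>h \<in> quandle_hom S T. (\<forall>i \<in> ?I. induced_map S T h i = g i) \<and> (\<forall>i \<in> ?I. h (b i) = e i)"
    if univ: "\<forall>f. (\<forall>i \<in> ?I. f i \<in> carrier (TT (g i))) \<longrightarrow>
      (\<exists>!h. h \<in> quandle_hom S T \<inter> extensional (carrier S) \<and> (\<forall>i \<in> ?I. h (b i) = f i))"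
  proof -
    \<comment> \<open>The selection \<open>f = e\<close> fixes the values at the base points;
      \<open>induced\<close> then identifies the induced map with \<open>g\<close>.\<close>
    obtain h where "h \<in> quandle_hom S T" "\<forall>i \<in> ?I. h (b i) = e i"
      using univ[rule_format, of e] e by blast
    then show ?thesis using induced e by (intro bexI[of _ h]) auto
  qed
  show ?thesis
    unfolding grp_homs_def[symmetric] using hom_imp imp_hom ex by blast
qed

end
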